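(* Let $X$ be a non-empty set of positive integers with $X\neq\{1\}$. At least one of $\Delta(X),\Gamma(X)$ contains a triangle (a cycle of length $3$) if and only if $B(X)$ contains an induced subgraph isomorphic to $C_6$ or to $K_{1,3}$.
   Context: For a non-empty set $X$ of positive integers, $\rho(X)$ is the set of primes dividing some element of $X$ and $X^*=X\setminus\{1\}$. $B(X)$ is the bipartite graph with vertex set the disjoint union $\rho(X)\cup X^*$ and edges $\{p,x\}$ for $p\in\rho(X)$, $x\in X^*$, $p\mid x$. $\Delta(X)$ has vertex set $\rho(X)$, distinct $p,q$ adjacent iff $pq$ divides some element of $X$. $\Gamma(X)$ has vertex set $X^*$, distinct $x,y$ adjacent iff $\gcd(x,y)>1$. $C_6$ is the cycle on $6$ vertices and $K_{1,3}$ the complete bipartite graph with parts of sizes $1$ and $3$. *)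

theory Defs
  imports "HOL-Computational_Algebra.Primes"
begin

text \<open>
  An undirected graph is a pair of a vertex set, possibly infinite, and a set of edges; it is simple
  if every edge is a two-element set of vertices.
\<close>

type_synonym 'a ugraph = "'a set \<times> 'a set set"

abbreviation verts :: "'a ugraph \<Rightarrow> 'a set" where "verts \<equiv> fst"
abbreviation edges :: "'a ugraph \<Rightarrow> 'a set set" where "edges \<equiv> snd"

definition simple_graph :: "'a ugraph \<Rightarrow> bool" where
  "simple_graph G \<longleftrightarrow> (\<forall>e\<in>edges G. e \<subseteq> verts G \<and> card e = 2)"

definition subgraph :: "'a ugraph \<Rightarrow> 'a ugraph \<Rightarrow> bool" where
  "subgraph H G \<longleftrightarrow> simple_graph H \<and> verts H \<subseteq> verts G \<and> edges H \<subseteq> edges G"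

definition induced :: "'a ugraph \<Rightarrow> 'a set \<Rightarrow> 'a ugraph" where
  "induced G S = (S, {e \<in> edges G. e \<subseteq> S})"

definition isomorphic :: "'a ugraph \<Rightarrow> 'b ugraph \<Rightarrow> bool" where
  "isomorphic G H \<longleftrightarrow> (\<exists>f. bij_betw f (verts G) (verts H) \<and>
     (\<forall>u\<in>verts G. \<forall>v\<in>verts G. {u, v} \<in> edges G \<longleftrightarrow> {f u, f v} \<in> edges H))"

definition contains_subgraph :: "'a ugraph \<Rightarrow> 'b ugraph \<Rightarrow> bool" where
  "contains_subgraph G K \<longleftrightarrow> (\<exists>H. subgraph H G \<and> isomorphic H K)"

definition contains_induced_subgraph :: "'a ugraph \<Rightarrow> 'b ugraph \<Rightarrow> bool" where
  "contains_induced_subgraph G K \<longleftrightarrow> (\<exists>S \<subseteq> verts G. isomorphic (induced G S) K)"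

text \<open>This is the cycle on \<open>n\<close> vertices only for \<open>n \<ge> 3\<close>.\<close>

definition cycle_graph :: "nat \<Rightarrow> nat ugraph" where
  "cycle_graph n = ({..<n}, {{i, (i + 1) mod n} |i. i < n})"

definition complete_bipartite :: "nat \<Rightarrow> nat \<Rightarrow> (nat + nat) ugraph" where
  "complete_bipartite m n =
     ({..<m} <+> {..<n}, {{Inl i, Inr j} |i j. i < m \<and> j < n})"

definition rho :: "nat set \<Rightarrow> nat set" where
  "rho X = {p. prime p \<and> (\<exists>x\<in>X. p dvd x)}"

text \<open>
  The sum type keeps the two parts of the bipartite graph disjoint: a prime may itself be
  an element of \<open>X\<close>.
\<close>

definition B_graph :: "nat set \<Rightarrow> (nat + nat) ugraph" where
  "B_graph X = (rho X <+> (X - {1}),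
     {{Inl p, Inr x} |p x. p \<in> rho X \<and> x \<in> X - {1} \<and> p dvd x})"

definition Delta_graph :: "nat set \<Rightarrow> nat ugraph" where
  "Delta_graph X = (rho X,
     {{p, q} |p q. p \<in> rho X \<and> q \<in> rho X \<and> p \<noteq> q \<and> (\<exists>x\<in>X. p * q dvd x)})"

definition Gamma_graph :: "nat set \<Rightarrow> nat ugraph" where
  "Gamma_graph X = (X - {1},
     {{x, y} |x y. x \<in> X - {1} \<and> y \<in> X - {1} \<and> x \<noteq> y \<and> gcd x y > 1})"

lemma simple_B_graph: "simple_graph (B_graph X)"
  by (auto simp: simple_graph_def B_graph_def)

lemma simple_Delta_graph: "simple_graph (Delta_graph X)"
  by (auto simp: simple_graph_def Delta_graph_def)

lemma simple_Gamma_graph: "simple_graph (Gamma_graph X)"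
  by (auto simp: simple_graph_def Gamma_graph_def)

lemma simple_complete_bipartite: "simple_graph (complete_bipartite m n)"
  by (auto simp: simple_graph_def complete_bipartite_def)

lemma simple_cycle_graph:
  assumes "n \<ge> 3"
  shows "simple_graph (cycle_graph n)"
proof -
  have "i \<noteq> Suc i mod n" if "i < n" for i
    using assms that by (cases "Suc i = n") auto
  then show ?thesis
    using assms by (auto simp: simple_graph_def cycle_graph_def)
qed

end

theory Submission
  imports Defs
begin

text \<open>
  A triangle in \<open>\<Delta>(X)\<close> gives three primes and, for each two of them, an element of \<open>X\<close> divisible
  by both. Either one of these elements is divisible by all three primes, and is the centre of an
  induced \<open>K\<^sub>1\<^sub>,\<^sub>3\<close>, or the three elements are distinct and form an induced \<open>C\<^sub>6\<close> with the primes.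
  Triangles in \<open>\<Gamma>(X)\<close> are treated dually, exchanging primes and elements. Conversely, the leaves of
  an induced \<open>K\<^sub>1\<^sub>,\<^sub>3\<close> and every other vertex of an induced \<open>C\<^sub>6\<close> form triangles.
\<close>

text \<open>Turns the isomorphism around: its inverse maps the pattern \<open>K\<close> into
  \<open>G\<close>. A copy of a small \<open>K\<close> can then be given, or analysed, by naming the
  images of its vertices one by one.\<close>

lemma contains_induced_subgraph_iff_embedding:
  "contains_induced_subgraph G K \<longleftrightarrow>
     (\<exists>g. inj_on g (verts K) \<and> g ` verts K \<subseteq> verts G \<and>
       (\<forall>u\<in>verts K. \<forall>v\<in>verts K. {g u, g v} \<in> edges G \<longleftrightarrow> {u, v} \<in> edges K))"
    (is "?L \<longleftrightarrow> ?R")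
proof
  assume ?L
  then obtain S f where S: "S \<subseteq> verts G" and f: "bij_betw f S (verts K)"
    and e: "\<And>u v. u \<in> S \<Longrightarrow> v \<in> S \<Longrightarrow> {u, v} \<in> edges G \<longleftrightarrow> {f u, f v} \<in> edges K"
    by (auto simp: contains_induced_subgraph_def isomorphic_def induced_def)
  let ?g = "inv_into S f"
  have g: "bij_betw ?g (verts K) S" using f by (rule bij_betw_inv_into)
  have fg: "f (?g u) = u" if "u \<in> verts K" for u
    using f that by (rule bij_betw_inv_into_right)
  have "?g u \<in> S" if "u \<in> verts K" for u
    using g that by (rule bij_betwE[rule_format])
  then show ?R
    using g S e fg by (intro exI[of _ ?g]) (auto simp: bij_betw_def)
next
  assume ?R
  then obtain g where i: "inj_on g (verts K)" and S: "g ` verts K \<subseteq> verts G"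
    and e: "\<forall>u\<in>verts K. \<forall>v\<in>verts K. {g u, g v} \<in> edges G \<longleftrightarrow> {u, v} \<in> edges K"
    by (elim exE conjE)
  have "bij_betw (inv_into (verts K) g) (g ` verts K) (verts K)"
    using i by (simp add: bij_betw_inv_into inj_on_imp_bij_betw)
  then have "isomorphic (induced G (g ` verts K)) K"
    unfolding isomorphic_def induced_def using i e
    by (intro exI[of _ "inv_into (verts K) g"]) auto
  then show ?L using S unfolding contains_induced_subgraph_def by blast
qed

text \<open>For the passage from \<open>B_graph\<close> to triangles: edges of the pattern yield
  divisibilities, and injectivity yields distinct primes or distinct elements.\<close>

lemma contains_induced_subgraphE:
  assumes "contains_induced_subgraph G K"
  obtains g where "inj_on g (verts K)"
    "\<And>u v. u \<in> verts K \<Longrightarrow> v \<in> verts K \<Longrightarrow> {u, v} \<in> edges K \<Longrightarrow> {g u, g v} \<in> edges G"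
  using assms unfolding contains_induced_subgraph_iff_embedding by (elim exE conjE) simp

lemma cycle_graph_3: "cycle_graph 3 = ({0, 1, 2}, {{0, 1}, {1, 2}, {2, 0}})"
proof -
  have "{..<3} = {0, 1, 2::nat}" by auto
  \<comment> \<open>Written as an image of an enumerated set, the edge set can be computed edge by
    edge.\<close>
  moreover have "{{i, (i + 1) mod 3} |i. i < 3} = (\<lambda>i. {i, (i + 1) mod 3}) ` {..<3::nat}" by auto
  ultimately show ?thesis by (simp add: cycle_graph_def numeral_2_eq_2)
qed

lemma cycle_graph_6:
  "cycle_graph 6 = ({0, 1, 2, 3, 4, 5}, {{0, 1}, {1, 2}, {2, 3}, {3, 4}, {4, 5}, {5, 0}})"
proof -
  have "{..<6} = {0, 1, 2, 3, 4, 5::nat}" by auto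
  moreover have "{{i, (i + 1) mod 6} |i. i < 6} = (\<lambda>i. {i, (i + 1) mod 6}) ` {..<6::nat}" by auto
  ultimately show ?thesis by (simp add: cycle_graph_def flip: numeral_2_eq_2)
qed

lemma complete_bipartite_1_3:
  "complete_bipartite 1 3 =
     ({Inl 0, Inr 0, Inr 1, Inr 2}, {{Inl 0, Inr 0}, {Inl 0, Inr 1}, {Inl 0, Inr 2}})"
proof -
  have *: "{..<3} = {0, 1, 2::nat}" by auto
  have "{{Inl i, Inr j} |i j. i < 1 \<and> j < 3} = (\<lambda>j. {Inl (0::nat), Inr j}) ` {..<3::nat}" by auto
  then show ?thesis by (auto simp: complete_bipartite_def *)
qed

text \<open>Edges of a simple graph have exactly two elements, so the three edges already force
  \<open>a\<close>, \<open>b\<close>, \<open>c\<close> to be distinct vertices.\<close>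

lemma contains_triangle_iff:
  assumes "simple_graph G"
  shows "contains_subgraph G (cycle_graph 3) \<longleftrightarrow>
    (\<exists>a b c. {a, b} \<in> edges G \<and> {b, c} \<in> edges G \<and> {c, a} \<in> edges G)"
    (is "?L \<longleftrightarrow> ?R")
proof
  assume ?L
  then obtain H f where H: "edges H \<subseteq> edges G" and f: "bij_betw f (verts H) {0, 1, 2::nat}"
    and e: "\<And>u v. u \<in> verts H \<Longrightarrow> v \<in> verts H \<Longrightarrow>
      {u, v} \<in> edges H \<longleftrightarrow> {f u, f v} \<in> {{0, 1}, {1, 2}, {2, 0}}"
    by (auto simp: contains_subgraph_def subgraph_def isomorphic_def cycle_graph_3)
  from f have im: "f ` verts H = {0, 1, 2}" by (simp add: bij_betw_def)
  obtain a where "a \<in> verts H" "f a = 0" using im by (metis imageE insertI1)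
  moreover obtain b where "b \<in> verts H" "f b = 1" using im by (metis imageE insertI1 insertI2)
  moreover obtain c where "c \<in> verts H" "f c = 2" using im by (metis imageE insertI1 insertI2)
  ultimately have "{a, b} \<in> edges H \<and> {b, c} \<in> edges H \<and> {c, a} \<in> edges H" by (simp add: e)
  then show ?R using H by blast
next
  assume ?R
  then obtain a b c where abc: "{a, b} \<in> edges G" "{b, c} \<in> edges G" "{c, a} \<in> edges G"
    by blast
  then have d: "a \<noteq> b" "b \<noteq> c" "c \<noteq> a" and v: "{a, b, c} \<subseteq> verts G"
    using assms by (fastforce simp: simple_graph_def)+
  define H where "H = ({a, b, c}, {{a, b}, {b, c}, {c, a}})"
  have "subgraph H G"
    using abc d v by (auto simp: subgraph_def simple_graph_def H_def)
  moreover have "isomorphic H (cycle_graph 3)"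
    unfolding isomorphic_def cycle_graph_3 H_def using d
    by (intro exI[of _ "\<lambda>u. if u = a then 0 else if u = b then 1 else 2"])
       (auto simp: bij_betw_def doubleton_eq_iff)
  ultimately show ?L unfolding contains_subgraph_def by blast
qed

text \<open>Distinct primes are coprime, so their product divides \<open>x\<close> as soon as both
  do; the same \<open>x\<close> witnesses membership in \<open>rho X\<close>.\<close>

lemma Delta_graph_edge_iff:
  "{p, q} \<in> edges (Delta_graph X) \<longleftrightarrow>
     prime p \<and> prime q \<and> p \<noteq> q \<and> (\<exists>x\<in>X. p dvd x \<and> q dvd x)"
proof -
  have "p * q dvd x \<longleftrightarrow> p dvd x \<and> q dvd x" if "prime p" "prime q" "p \<noteq> q" for x
    using that by (meson divides_mult dvd_mult_left dvd_mult_right primes_coprime)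
  moreover have "{p, q} \<in> edges (Delta_graph X) \<longleftrightarrow>
      p \<in> rho X \<and> q \<in> rho X \<and> p \<noteq> q \<and> (\<exists>x\<in>X. p * q dvd x)"
    unfolding Delta_graph_def snd_conv mem_Collect_eq doubleton_eq_iff
    by (metis mult.commute)
  ultimately show ?thesis
    unfolding rho_def by blast
qed

text \<open>Replacing the gcd by a common prime divisor makes adjacency here the dual of adjacency
  in \<open>Delta_graph\<close>.\<close>

lemma Gamma_graph_edge_iff:
  "{x, y} \<in> edges (Gamma_graph X) \<longleftrightarrow>
     x \<in> X - {1} \<and> y \<in> X - {1} \<and> x \<noteq> y \<and> (\<exists>p. prime p \<and> p dvd x \<and> p dvd y)"
proof -
  have "gcd x y > 1 \<longleftrightarrow> (\<exists>p. prime p \<and> p dvd x \<and> p dvd y)" if "x \<noteq> y"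
  proof
    assume "gcd x y > 1"
    then obtain p where "prime p" "p dvd gcd x y" by (metis nat_neq_iff prime_factor_nat)
    then show "\<exists>p. prime p \<and> p dvd x \<and> p dvd y" by auto
  next
    assume "\<exists>p. prime p \<and> p dvd x \<and> p dvd y"
    then obtain p where "prime p" "p dvd gcd x y" by auto
    \<comment> \<open>The gcd vanishes only for x = y = 0, which distinctness excludes.\<close>
    moreover have "gcd x y \<noteq> 0" using that by auto
    ultimately show "gcd x y > 1"
      by (metis dvd_imp_le less_le_trans neq0_conv prime_gt_1_nat)
  qed
  then show ?thesis
    by (auto simp: Gamma_graph_def doubleton_eq_iff gcd.commute)
qed

text \<open>The negative clauses say that both parts are independent. The singleton clause covers
  the pairs {u, v} with u = v that occur in the embedding criterion.\<close>

lemma B_graph_edge_iff: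
  "{Inl p, Inr x} \<in> edges (B_graph X) \<longleftrightarrow> prime p \<and> x \<in> X - {1} \<and> p dvd x"
  "{Inr x, Inl p} \<in> edges (B_graph X) \<longleftrightarrow> prime p \<and> x \<in> X - {1} \<and> p dvd x"
  "{Inl p, Inl q} \<notin> edges (B_graph X)"
  "{Inr x, Inr y} \<notin> edges (B_graph X)"
  "{c} \<notin> edges (B_graph X)"
  by (auto simp: B_graph_def rho_def doubleton_eq_iff)

text \<open>The three neighbours of \<open>c\<close> all lie in the part opposite to it, so no two
  of them are adjacent and the star is induced. The centre may be a prime or an element, which
  serves both dual cases.\<close>

lemma B_graph_contains_K13I:
  assumes "u \<noteq> v" "v \<noteq> w" "w \<noteq> u"
    "{c, u} \<in> edges (B_graph X)" "{c, v} \<in> edges (B_graph X)" "{c, w} \<in> edges (B_graph X)"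
  shows "contains_induced_subgraph (B_graph X) (complete_bipartite 1 3)"
proof -
  define g where "g = case_sum (\<lambda>_::nat. c) (\<lambda>j::nat. if j = 0 then u else if j = 1 then v else w)"
  have "{c, u, v, w} \<subseteq> verts (B_graph X)"
    using assms(4-6) simple_B_graph[of X] by (auto simp: simple_graph_def)
  then show ?thesis
    unfolding contains_induced_subgraph_iff_embedding complete_bipartite_1_3
    using assms
    by (intro exI[of _ g], cases c; cases u; cases v; cases w)
       (simp_all add: g_def B_graph_edge_iff doubleton_eq_iff)
qed

text \<open>The hexagon is p, x, q, y, r, z in this order. Its only other prime-element pairs are
  the long diagonals, which \<open>nd\<close> excludes; together with \<open>d\<close> this also
  makes the primes distinct and the elements distinct.\<close>

lemma B_graph_contains_C6I:
  assumes pr: "prime p" "prime q" "prime r" and X: "x \<in> X - {1}" "y \<in> X - {1}" "z \<in> X - {1}"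
    and d: "p dvd x" "q dvd x" "q dvd y" "r dvd y" "r dvd z" "p dvd z"
    and nd: "\<not> p dvd y" "\<not> q dvd z" "\<not> r dvd x"
  shows "contains_induced_subgraph (B_graph X) (cycle_graph 6)"
proof -
  define g :: "nat \<Rightarrow> nat + nat" where "g = (!) [Inl p, Inr x, Inl q, Inr y, Inl r, Inr z]"
  have ne: "p \<noteq> q" "q \<noteq> r" "p \<noteq> r" "x \<noteq> y" "y \<noteq> z" "x \<noteq> z"
    using d nd by auto
  have "p \<in> rho X" "q \<in> rho X" "r \<in> rho X" using pr X d by (auto simp: rho_def)
  then have v: "g ` {0, 1, 2, 3, 4, 5} \<subseteq> verts (B_graph X)"
    using X by (auto simp: B_graph_def g_def)
  show ?thesis
    unfolding contains_induced_subgraph_iff_embedding cycle_graph_6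
    using pr X d nd ne v
    by (intro exI[of _ g]) (simp add: g_def B_graph_edge_iff doubleton_eq_iff)
qed

theorem theorem4p1:
  fixes X :: "nat set"
  assumes "X \<noteq> {}" and "\<forall>x\<in>X. x > 0" and "X \<noteq> {1}"
  shows "(contains_subgraph (Delta_graph X) (cycle_graph 3) \<or>
          contains_subgraph (Gamma_graph X) (cycle_graph 3)) \<longleftrightarrow>
         (contains_induced_subgraph (B_graph X) (cycle_graph 6) \<or>
          contains_induced_subgraph (B_graph X) (complete_bipartite 1 3))"
    (is "?D \<or> ?G \<longleftrightarrow> ?C \<or> ?K")
proof
  have star: "x \<in> X - {1}" if "prime p" "x \<in> X" "p dvd x" for p x
    using that by (auto dest: not_prime_unit)
  have K_elem: ?K if "prime p" "prime q" "prime r" "p \<noteq> q" "q \<noteq> r" "r \<noteq> p"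
    "x \<in> X" "p dvd x" "q dvd x" "r dvd x" for p q r x
    by (rule B_graph_contains_K13I[of "Inl p" "Inl q" "Inl r" "Inr x"])
       (use that star in \<open>simp_all add: B_graph_edge_iff\<close>)
  have K_prime: ?K if "prime p" "x \<in> X" "y \<in> X" "z \<in> X" "x \<noteq> y" "y \<noteq> z" "z \<noteq> x"
    "p dvd x" "p dvd y" "p dvd z" for p x y z
    by (rule B_graph_contains_K13I[of "Inr x" "Inr y" "Inr z" "Inl p"])
       (use that star in \<open>simp_all add: B_graph_edge_iff\<close>)
  assume "?D \<or> ?G"
  then show "?C \<or> ?K"
  proof
    assume ?D
    then obtain p q r x y z where *: "prime p" "prime q" "prime r" "p \<noteq> q" "q \<noteq> r" "r \<noteq> p"
      "x \<in> X" "p dvd x" "q dvd x" "y \<in> X" "q dvd y" "r dvd y" "z \<in> X" "r dvd z" "p dvd z"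
      by (auto simp: contains_triangle_iff[OF simple_Delta_graph] Delta_graph_edge_iff)
    show ?thesis
    \<comment> \<open>A long diagonal gives an element divisible by all three primes. If two of
      \<open>x\<close>, \<open>y\<close>, \<open>z\<close> coincide, a long diagonal is present, so
      this case is covered too.\<close>
    proof (cases "p dvd y \<or> q dvd z \<or> r dvd x")
      case True
      then show ?thesis using * K_elem by blast
    next
      case False
      then show ?thesis using * star B_graph_contains_C6I[of p q r x X y z] by blast
    qed
  next
    assume ?G
    then obtain x y z p q r where *: "x \<in> X" "y \<in> X" "z \<in> X" "x \<noteq> y" "y \<noteq> z" "z \<noteq> x"
      "prime p" "p dvd x" "p dvd y" "prime q" "q dvd y" "q dvd z" "prime r" "r dvd z" "r dvd x"
      by (auto simp: contains_triangle_iff[OF simple_Gamma_graph] Gamma_graph_edge_iff)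
    show ?thesis
    \<comment> \<open>Dually, coinciding primes fall under the first case. In the second case the
      hexagon is r, x, p, y, q, z.\<close>
    proof (cases "p dvd z \<or> q dvd x \<or> r dvd y")
      case True
      then show ?thesis using * K_prime by blast
    next
      case False
      then show ?thesis using * star B_graph_contains_C6I[of r p q x X y z] by blast
    qed
  qed
next
  have Delta: ?D if "prime p" "prime q" "prime r" "p \<noteq> q" "q \<noteq> r" "r \<noteq> p"
    "x \<in> X" "p dvd x" "q dvd x" "y \<in> X" "q dvd y" "r dvd y" "z \<in> X" "r dvd z" "p dvd z"
    for p q r x y z
    unfolding contains_triangle_iff[OF simple_Delta_graph] Delta_graph_edge_iff
    using that by blast
  have Gamma: ?G if "x \<in> X - {1}" "y \<in> X - {1}" "z \<in> X - {1}" "x \<noteq> y" "y \<noteq> z" "z \<noteq> x"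
    "prime p" "p dvd x" "p dvd y" "p dvd z" for x y z p
    unfolding contains_triangle_iff[OF simple_Gamma_graph] Gamma_graph_edge_iff
    using that by blast
  assume "?C \<or> ?K"
  then show "?D \<or> ?G"
  proof
    assume ?C
    then obtain g where i: "inj_on g (verts (cycle_graph 6))"
      and g: "\<And>u v. u \<in> verts (cycle_graph 6) \<Longrightarrow> v \<in> verts (cycle_graph 6) \<Longrightarrow>
        {u, v} \<in> edges (cycle_graph 6) \<Longrightarrow> {g u, g v} \<in> edges (B_graph X)"
      by (rule contains_induced_subgraphE) blast
    have e: "{g 0, g 1} \<in> edges (B_graph X)" "{g 1, g 2} \<in> edges (B_graph X)"
        "{g 2, g 3} \<in> edges (B_graph X)" "{g 3, g 4} \<in> edges (B_graph X)"
        "{g 4, g 5} \<in> edges (B_graph X)" "{g 5, g 0} \<in> edges (B_graph X)"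
      by (rule g; simp add: cycle_graph_6)+
    have ne: "g 0 \<noteq> g 2" "g 2 \<noteq> g 4" "g 4 \<noteq> g 0"
        "g 1 \<noteq> g 3" "g 3 \<noteq> g 5" "g 5 \<noteq> g 1"
      using i by (simp_all add: inj_on_def cycle_graph_6)
    have ?D
    \<comment> \<open>Consecutive vertices lie in opposite parts, so the primes occupy all even or
      all odd positions, depending on \<open>g 0\<close>. Any two of them share the element between
      them on the cycle.\<close>
    proof (cases "g 0")
      case (Inl p)
      with e obtain x q y r z where "g 1 = Inr x" "g 2 = Inl q" "g 3 = Inr y" "g 4 = Inl r"
        "g 5 = Inr z"
        by (metis B_graph_edge_iff(3,4) sum.exhaust)
      with Inl e ne show ?thesis
        by (intro Delta[of p q r x y z]) (auto simp: B_graph_edge_iff)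
    next
      case (Inr x)
      with e obtain p y q z r where "g 1 = Inl p" "g 2 = Inr y" "g 3 = Inl q" "g 4 = Inr z"
        "g 5 = Inl r"
        by (metis B_graph_edge_iff(3,4) sum.exhaust)
      with Inr e ne show ?thesis
        by (intro Delta[of p q r y z x]) (auto simp: B_graph_edge_iff)
    qed
    then show ?thesis ..
  next
    assume ?K
    then obtain g where i: "inj_on g (verts (complete_bipartite 1 3))"
      and g: "\<And>u v. u \<in> verts (complete_bipartite 1 3) \<Longrightarrow>
        v \<in> verts (complete_bipartite 1 3) \<Longrightarrow>
        {u, v} \<in> edges (complete_bipartite 1 3) \<Longrightarrow> {g u, g v} \<in> edges (B_graph X)"
      by (rule contains_induced_subgraphE) blast
    have e: "{g (Inl 0), g (Inr 0)} \<in> edges (B_graph X)"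
        "{g (Inl 0), g (Inr 1)} \<in> edges (B_graph X)"
        "{g (Inl 0), g (Inr 2)} \<in> edges (B_graph X)"
      by (rule g; unfold complete_bipartite_1_3; simp)+
    have ne: "g (Inr 0) \<noteq> g (Inr 1)" "g (Inr 1) \<noteq> g (Inr 2)" "g (Inr 2) \<noteq> g (Inr 0)"
      using i unfolding complete_bipartite_1_3 by (simp_all add: inj_on_def)
    show ?thesis
    \<comment> \<open>A prime at the centre is a common divisor of three elements, giving a triangle
      in \<open>Gamma_graph\<close>. An element at the centre witnesses all three edges of a
      triangle in \<open>Delta_graph\<close>.\<close>
    proof (cases "g (Inl 0)")
      case (Inl p)
      with e obtain x y z where "g (Inr 0) = Inr x" "g (Inr 1) = Inr y" "g (Inr 2) = Inr z"
        by (metis B_graph_edge_iff(3) sum.exhaust)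
      with Inl e ne have ?G
        by (intro Gamma[of x y z p]) (auto simp: B_graph_edge_iff)
      then show ?thesis ..
    next
      case (Inr x)
      with e obtain p q r where "g (Inr 0) = Inl p" "g (Inr 1) = Inl q" "g (Inr 2) = Inl r"
        by (metis B_graph_edge_iff(4) sum.exhaust)
      with Inr e ne have ?D
        by (intro Delta[of p q r x x x]) (auto simp: B_graph_edge_iff)
      then show ?thesis ..
    qed
  qed
qed

end
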